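(* Let $T$ be a rooted tree. The coheight profile profile $\mathbf{x}_{\mathbf{x}_h}=\prod_{v\in V(T)}x_{\mathbf{x}_h|_v}$ of $T$ can be reconstructed from the sampling function $F_T$; that is, if $T,T'$ are rooted trees with $F_T=F_{T'}$, then $\mathbf{x}_{\mathbf{x}_h}(T)=\mathbf{x}_{\mathbf{x}_h}(T')$.
   Context: $T$ is a finite rooted tree with root $v_T$; $h_v$ is the coheight of $v$ (length of the path from $v_T$ to $v$); $S_v$ is the subtree of $v$ and its descendants. $\mathbf{x}_h|_v=\prod_{u\in V(S_v)}x_{h_u}$ is the coheight profile of $v$ (a monomial in $x_0,x_1,\dots$). The coheight profile profile is the formal product $\prod_{v\in V(T)}x_{\mathbf{x}_h|_v}$ in indeterminates indexed by monomials. A coloring $f\colon V(T)\to\mathbb{Z}^+$ is increasing if $f(u)<f(v)$ whenever $u$ is the parent of $v$; $\Gamma^<(T;\mathbf{x})=\sum_{f\text{ increasing}}\prod_v x_{f(v)}$. Monomials are ordered lexicographically by exponent tuples (larger exponent at the first differing index means larger). For $n\in\mathbb{N}$, $\left[\prod_{i\le n}x_i^{e_i}\right]p$ is the sum of terms of $p$ whose exponent of $x_i$ equals $e_i$ for all $i\le n$. The sampling function is $F_T\left(\prod_{i\le n}x_i^{e_i}\right)=\max\left(\left[\prod_{i\le n}x_i^{e_i}\right]\Gamma^<(T;\mathbf{x})\right)$ (greatest such monomial, or $\varnothing$ if none). *)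

theory Defs
  imports "Graph_Theory.Arc_Walk" "HOL-Library.Poly_Mapping" "HOL-Library.FuncSet"
begin

text \<open>
  A rooted tree is a finite digraph whose arcs point from parent to child and in which every
  vertex is the end of exactly one walk from the root. Uniqueness excludes loops, parallel arcs
  and arcs into the root.
\<close>

locale rooted_tree = fin_digraph G for G :: "('a, 'b) pre_digraph" +
  fixes r :: 'a
  assumes root_in_verts: "r \<in> verts G"
    and unique_walk: "\<And>v. v \<in> verts G \<Longrightarrow> \<exists>!p. awalk r p v"

definition coheight :: "('a, 'b) pre_digraph \<Rightarrow> 'a \<Rightarrow> 'a \<Rightarrow> nat" where
  "coheight G r v = length (THE p. pre_digraph.awalk G r p v)"

definition subtree_verts :: "('a, 'b) pre_digraph \<Rightarrow> 'a \<Rightarrow> 'a set" where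
  "subtree_verts G v = {u. v \<rightarrow>\<^sup>*\<^bsub>G\<^esub> u}"

text \<open>
  A monomial in variables indexed by \<open>'i\<close> is represented by its exponents. Monomials are thus
  written additively: \<open>Poly_Mapping.single i 1\<close> is the variable \<open>x\<^sub>i\<close>, and a sum is the product of
  monomials. The library order on \<^typ>\<open>nat \<Rightarrow>\<^sub>0 nat\<close> is the lexicographic one; see
  \<open>monomial_less_iff\<close>.
\<close>

type_synonym 'i monomial = "'i \<Rightarrow>\<^sub>0 nat"

lemma monomial_less_iff:
  fixes m m' :: "nat monomial"
  shows "m < m' \<longleftrightarrow> (\<exists>k. Poly_Mapping.lookup m k < Poly_Mapping.lookup m' k \<and>
    (\<forall>i<k. Poly_Mapping.lookup m i = Poly_Mapping.lookup m' i))"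
  by (auto simp: less_poly_mapping.rep_eq less_fun_def)

definition coheight_profile :: "('a, 'b) pre_digraph \<Rightarrow> 'a \<Rightarrow> 'a \<Rightarrow> nat monomial" where
  "coheight_profile G r v =
     (\<Sum>u\<in>subtree_verts G v. Poly_Mapping.single (coheight G r u) 1)"

definition coheight_profile_profile ::
    "('a, 'b) pre_digraph \<Rightarrow> 'a \<Rightarrow> nat monomial monomial" where
  "coheight_profile_profile G r =
     (\<Sum>v\<in>verts G. Poly_Mapping.single (coheight_profile G r v) 1)"

text \<open>A formal power series in \<open>x\<^sub>0, x\<^sub>1, \<dots>\<close> is represented by its coefficients.\<close>

type_synonym power_series = "nat monomial \<Rightarrow> int"

definition increasing_colorings :: "('a, 'b) pre_digraph \<Rightarrow> ('a \<Rightarrow> nat) set" where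
  "increasing_colorings G =
     {f \<in> verts G \<rightarrow>\<^sub>E {1..}. \<forall>u v. u \<rightarrow>\<^bsub>G\<^esub> v \<longrightarrow> f u < f v}"

definition coloring_monomial :: "('a, 'b) pre_digraph \<Rightarrow> ('a \<Rightarrow> nat) \<Rightarrow> nat monomial" where
  "coloring_monomial G f = (\<Sum>v\<in>verts G. Poly_Mapping.single (f v) 1)"

text \<open>
  The coefficient of \<open>m\<close> in the sum of the monomials of all increasing colorings is the number
  of those colorings whose monomial is \<open>m\<close>.
\<close>

definition Gamma_less :: "('a, 'b) pre_digraph \<Rightarrow> power_series" where
  "Gamma_less G m = int (card {f \<in> increasing_colorings G. coloring_monomial G f = m})"

lemma finite_colorings_with_monomial:
  assumes "finite (verts G)"
  shows "finite {f \<in> increasing_colorings G. coloring_monomial G f = m}"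
proof (rule finite_subset)
  show "finite (verts G \<rightarrow>\<^sub>E Poly_Mapping.keys m)"
    using assms by (intro finite_PiE) auto
  have keys: "f v \<in> Poly_Mapping.keys (coloring_monomial G f)" if "v \<in> verts G" for f v
  proof -
    have "Poly_Mapping.lookup (coloring_monomial G f) (f v) =
        (\<Sum>u\<in>verts G. Poly_Mapping.lookup (Poly_Mapping.single (f u) (1::nat)) (f v))"
      by (simp add: coloring_monomial_def lookup_sum)
    also have "\<dots> \<ge> Poly_Mapping.lookup (Poly_Mapping.single (f v) (1::nat)) (f v)"
      using assms that by (intro member_le_sum) auto
    finally show ?thesis
      by (simp add: in_keys_iff)
  qed
  show "{f \<in> increasing_colorings G. coloring_monomial G f = m}
      \<subseteq> verts G \<rightarrow>\<^sub>E Poly_Mapping.keys m"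
  proof
    fix f assume "f \<in> {f \<in> increasing_colorings G. coloring_monomial G f = m}"
    then have "f \<in> extensional (verts G)" and "coloring_monomial G f = m"
      by (simp_all add: increasing_colorings_def PiE_iff)
    then show "f \<in> verts G \<rightarrow>\<^sub>E Poly_Mapping.keys m"
      using keys[of _ f] by (simp add: PiE_iff)
  qed
qed

text \<open>The variables of \<^const>\<open>Gamma_less\<close> start at \<open>x\<^sub>1\<close>, so \<open>i \<le> n\<close> means \<open>1 \<le> i \<le> n\<close>.\<close>

definition extract_terms :: "nat \<Rightarrow> (nat \<Rightarrow> nat) \<Rightarrow> power_series \<Rightarrow> power_series" where
  "extract_terms n e p = (\<lambda>m. if \<forall>i\<in>{1..n}. Poly_Mapping.lookup m i = e i then p m else 0)"

text \<open>
  \<^const>\<open>None\<close> plays the role of \<open>\<emptyset>\<close>. A nonzero homogeneous power series does have a greatest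
  monomial, although infinitely many monomials may occur in it.
\<close>

definition max_monomial :: "power_series \<Rightarrow> nat monomial option" where
  "max_monomial p =
     (if \<exists>m. p m \<noteq> 0 then Some (GREATEST m. p m \<noteq> 0) else None)"

text \<open>
  The argument \<open>\<Prod>i\<le>n. x\<^sub>i ^ e i\<close> is given by the bound \<open>n\<close> and the exponents \<open>e\<close>, because the
  bound is not determined by the monomial when trailing exponents are zero.
\<close>

definition sampling_function ::
    "('a, 'b) pre_digraph \<Rightarrow> nat \<Rightarrow> (nat \<Rightarrow> nat) \<Rightarrow> nat monomial option" where
  "sampling_function G n e = max_monomial (extract_terms n e (Gamma_less G))"

end

theory Submission
  imports Defs "HOL-Library.Multiset"
begin

text \<open>
  Coloring every vertex by its coheight plus one is the lexicographically greatest increasing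
  coloring, so \<open>F\<^sub>T\<close> at the empty constraint gives the number \<open>L\<^sub>i\<close> of vertices of each
  coheight \<open>i\<close>. Prescribing the exponents \<open>L\<^sub>0, \<dots>, L\<^bsub>h-1\<^esub>, L\<^sub>h - k\<close> forces all vertices above
  coheight \<open>h\<close> to keep this color and delays exactly \<open>k\<close> vertices of coheight \<open>h\<close>. For a given
  set \<open>K\<close> of delayed vertices it is best to shift the subtrees of \<open>K\<close> by one color, and the resulting
  monomial is a strictly decreasing function of the product of the coheight profiles of \<open>K\<close>. Hence
  \<open>F\<^sub>T\<close> determines, for all \<open>h\<close> and \<open>k\<close>, the least product of \<open>k\<close> profiles at coheight \<open>h\<close>; these
  minima determine the multiset of profiles at coheight \<open>h\<close>.
\<close>

section \<open>Multisets determined by minimal subset sums\<close>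

lemma obtain_max:
  fixes f :: "'a \<Rightarrow> 'm::linorder"
  assumes "finite A" "A \<noteq> {}"
  obtains a where "a \<in> A" "\<And>c. c \<in> A \<Longrightarrow> f c \<le> f a"
proof -
  have "Max (f ` A) \<in> f ` A"
    using assms by simp
  then obtain a where a: "a \<in> A" "Max (f ` A) = f a"
    by auto
  then show ?thesis
    using that[of a] Max_ge[OF finite_imageI[OF assms(1)], of _ f] by simp
qed

text \<open>If \<open>b\<close> lies in \<open>K\<close>, some \<open>c\<close> of \<open>B\<close>
  lies outside \<open>K\<close> because \<open>K\<close> is smaller than \<open>B\<close>; trading
  \<open>b\<close> for \<open>c\<close> cannot raise the sum, as \<open>q b\<close> is
  maximal.\<close>

lemma exchange_max:
  fixes q :: "'b \<Rightarrow> 'm::{linorder, ordered_comm_monoid_add}"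
  assumes "finite B" "K \<subseteq> B" "card K < card B" "b \<in> B" "\<And>c. c \<in> B \<Longrightarrow> q c \<le> q b"
  shows "\<exists>K'\<subseteq>B - {b}. card K' = card K \<and> sum q K' \<le> sum q K"
proof (cases "b \<in> K")
  case True
  have finK: "finite K"
    using assms finite_subset by blast
  obtain c where c: "c \<in> B" "c \<notin> K"
    using assms by (metis psubsetE subset_antisym subsetI less_irrefl)
  let ?K = "insert c (K - {b})"
  have "card ?K = card K"
    using c True finK by (metis Diff_iff card_Suc_Diff1 card_insert_disjoint finite_Diff)
  moreover have "sum q ?K \<le> sum q K"
  proof -
    have "sum q ?K = q c + sum q (K - {b})"
      using c finK by simp
    also have "\<dots> \<le> q b + sum q (K - {b})"
      using assms(5) c by (simp add: add_right_mono)
    also have "\<dots> = sum q K"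
      using True finK by (simp add: sum.remove)
    finally show ?thesis .
  qed
  moreover have "?K \<subseteq> B - {b}"
    using c True assms by auto
  ultimately show ?thesis
    by blast
next
  case False
  then show ?thesis
    using assms by (intro exI[of _ K]) auto
qed

text \<open>Equality of the minimal sums for each size is expressed by mutual domination. The
  induction removes a maximal element from both sides: by exchange, the domination survives on the
  remaining sets.\<close>

lemma image_mset_eq_if_min_subset_sums_eq:
  fixes p :: "'a \<Rightarrow> 'm::{linorder, ordered_cancel_comm_monoid_add}" and q :: "'b \<Rightarrow> 'm"
  assumes "finite A" "finite B" "card A = card B"
    and "\<And>K. K \<subseteq> A \<Longrightarrow> \<exists>K'\<subseteq>B. card K' = card K \<and> sum q K' \<le> sum p K"
    and "\<And>K. K \<subseteq> B \<Longrightarrow> \<exists>K'\<subseteq>A. card K' = card K \<and> sum p K' \<le> sum q K"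
  shows "image_mset p (mset_set A) = image_mset q (mset_set B)"
  using assms
proof (induction "card A" arbitrary: A B)
  case 0
  then show ?case
    by simp
next
  case (Suc n)
  obtain a where a: "a \<in> A" "\<And>c. c \<in> A \<Longrightarrow> p c \<le> p a"
    by (rule obtain_max[of A p]) (use Suc.hyps(2) Suc.prems in auto)
  obtain b where b: "b \<in> B" "\<And>c. c \<in> B \<Longrightarrow> q c \<le> q b"
    by (rule obtain_max[of B q]) (use Suc.hyps(2) Suc.prems in auto)
  have *: "\<exists>K'\<subseteq>B - {b}. card K' = card K \<and> sum q K' \<le> sum p K" if "K \<subseteq> A - {a}" for K
  proof -
    obtain K' where K': "K' \<subseteq> B" "card K' = card K" "sum q K' \<le> sum p K"
      using Suc.prems(4) \<open>K \<subseteq> A - {a}\<close> by (meson Diff_subset subset_trans)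
    have "card K < card A"
      using that a Suc.prems(1) by (intro psubset_card_mono) auto
    then show ?thesis
      using exchange_max[of B K' b q] K' b Suc.prems by (metis order_trans)
  qed
  have **: "\<exists>K'\<subseteq>A - {a}. card K' = card K \<and> sum p K' \<le> sum q K" if "K \<subseteq> B - {b}" for K
  proof -
    obtain K' where K': "K' \<subseteq> A" "card K' = card K" "sum p K' \<le> sum q K"
      using Suc.prems(5) \<open>K \<subseteq> B - {b}\<close> by (meson Diff_subset subset_trans)
    have "card K < card B"
      using that b Suc.prems(2) by (intro psubset_card_mono) auto
    then show ?thesis
      using exchange_max[of A K' a p] K' a Suc.prems by (metis order_trans)
  qed
  have IH: "image_mset p (mset_set (A - {a})) = image_mset q (mset_set (B - {b}))"
    using Suc.hyps Suc.prems a b * ** by (intro Suc.hyps(1)) auto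
  then have rest: "sum p (A - {a}) = sum q (B - {b})"
    by (simp add: sum_unfold_sum_mset)
  \<comment> \<open>Domination for the full sets compares the total sums, since a subset of full
    cardinality is the whole set. Cancelling the equal sums of the rest leaves
    \<open>p a = q b\<close>.\<close>
  have "sum p A = sum q B"
  proof (rule antisym)
    obtain K where "K \<subseteq> A" "card K = card B" "sum p K \<le> sum q B"
      using Suc.prems(5)[of B] by auto
    then show "sum p A \<le> sum q B"
      using Suc.prems card_subset_eq by metis
    obtain K' where "K' \<subseteq> B" "card K' = card A" "sum q K' \<le> sum p A"
      using Suc.prems(4)[of A] by auto
    then show "sum q B \<le> sum p A"
      using Suc.prems card_subset_eq by metis
  qed
  then have "p a = q b"
    using rest a b Suc.prems by (simp add: sum.remove)
  then show ?case
    using IH a b Suc.prems by (simp add: mset_set.remove)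
qed

section \<open>Monomials of colorings\<close>

lemma lookup_sum_single:
  assumes "finite A"
  shows "Poly_Mapping.lookup (\<Sum>v\<in>A. Poly_Mapping.single (f v) (1::nat)) i = card {v\<in>A. f v = i}"
proof -
  have "Poly_Mapping.lookup (\<Sum>v\<in>A. Poly_Mapping.single (f v) (1::nat)) i =
      (\<Sum>v\<in>A. if f v = i then 1 else 0)"
    by (simp add: lookup_sum lookup_single when_def cong: if_cong)
  also have "\<dots> = card {v\<in>A. f v = i}"
    using sum.inter_filter[OF assms, of "\<lambda>_. 1::nat" "\<lambda>v. f v = i"] by simp
  finally show ?thesis .
qed

lemma lookup_coloring_monomial:
  assumes "finite (verts G)"
  shows "Poly_Mapping.lookup (coloring_monomial G f) i = card {v\<in>verts G. f v = i}"
  unfolding coloring_monomial_def by (rule lookup_sum_single[OF assms])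

text \<open>Let \<open>k\<close> be the least \<open>g\<close>-color of a vertex on which
  \<open>f\<close> and \<open>g\<close> differ. All color classes below \<open>k\<close> agree, and
  passing from \<open>g\<close> to \<open>f\<close> the class of \<open>k\<close> only loses
  vertices, at least one of them.\<close>

lemma coloring_monomial_antimono:
  assumes fin: "finite (verts G)" and le: "\<And>v. v \<in> verts G \<Longrightarrow> g v \<le> f v"
  shows "coloring_monomial G f \<le> coloring_monomial G g"
proof (cases "\<exists>v\<in>verts G. f v \<noteq> g v")
  case True
  define k where "k = (LEAST k. \<exists>v\<in>verts G. f v \<noteq> g v \<and> g v = k)"
  have "\<exists>v\<in>verts G. f v \<noteq> g v \<and> g v = k"
    unfolding k_def by (rule LeastI_ex) (use True in auto)
  then obtain w where w: "w \<in> verts G" "f w \<noteq> g w" "g w = k"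
    by blast
  have eq: "f v = g v" if "v \<in> verts G" "g v < k" for v
    using not_less_Least[of "g v" "\<lambda>k. \<exists>v\<in>verts G. f v \<noteq> g v \<and> g v = k"] that
    by (auto simp: k_def)
  have "{v\<in>verts G. f v = i} = {v\<in>verts G. g v = i}" if "i < k" for i
    using eq le that by (metis (no_types, lifting) le_less_trans)
  moreover have "{v\<in>verts G. f v = k} \<subset> {v\<in>verts G. g v = k}"
  proof
    show "{v\<in>verts G. f v = k} \<subseteq> {v\<in>verts G. g v = k}"
      using eq le by (auto, metis order_le_less)
    show "{v\<in>verts G. f v = k} \<noteq> {v\<in>verts G. g v = k}"
      using w by auto
  qed
  then have "card {v\<in>verts G. f v = k} < card {v\<in>verts G. g v = k}"
    using fin by (intro psubset_card_mono) auto
  ultimately have "coloring_monomial G f < coloring_monomial G g"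
    using fin by (auto simp: monomial_less_iff lookup_coloring_monomial intro!: exI[of _ k])
  then show ?thesis
    by simp
next
  case False
  then have "coloring_monomial G f = coloring_monomial G g"
    by (simp add: coloring_monomial_def)
  then show ?thesis
    by simp
qed

text \<open>The coefficients count colorings, so nothing cancels; finiteness is essential because
  \<open>card\<close> of an infinite set is 0.\<close>

lemma Gamma_less_neq_0_iff:
  assumes "finite (verts G)"
  shows "Gamma_less G m \<noteq> 0 \<longleftrightarrow> (\<exists>f\<in>increasing_colorings G. coloring_monomial G f = m)"
  using finite_colorings_with_monomial[OF assms, of m] by (auto simp: Gamma_less_def)

text \<open>Turns the value of the sampling function into an optimization over colorings. Exhibiting
  an optimal coloring also settles that the greatest monomial exists.\<close>

lemma sampling_function_eqI:
  assumes "finite (verts G)" and "f \<in> increasing_colorings G"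
    and "\<And>i. i \<in> {1..n} \<Longrightarrow> card {v\<in>verts G. f v = i} = e i"
    and "\<And>g. g \<in> increasing_colorings G \<Longrightarrow>
      (\<And>i. i \<in> {1..n} \<Longrightarrow> card {v\<in>verts G. g v = i} = e i) \<Longrightarrow>
      coloring_monomial G g \<le> coloring_monomial G f"
  shows "sampling_function G n e = Some (coloring_monomial G f)"
proof -
  define p where "p = extract_terms n e (Gamma_less G)"
  have p: "p m \<noteq> 0 \<longleftrightarrow> (\<exists>g\<in>increasing_colorings G. coloring_monomial G g = m \<and>
      (\<forall>i\<in>{1..n}. card {v\<in>verts G. g v = i} = e i))" for m
    using assms(1) Gamma_less_neq_0_iff[OF assms(1), of m]
    by (auto simp: p_def extract_terms_def lookup_coloring_monomial[OF assms(1), symmetric])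
  have "p (coloring_monomial G f) \<noteq> 0"
    unfolding p using assms(2,3) by blast
  moreover have "m \<le> coloring_monomial G f" if nz: "p m \<noteq> 0" for m
  proof -
    obtain g where "g \<in> increasing_colorings G" "coloring_monomial G g = m"
      "\<forall>i\<in>{1..n}. card {v\<in>verts G. g v = i} = e i"
      using nz unfolding p by blast
    then show ?thesis
      using assms(4)[of g] by simp
  qed
  ultimately have "(GREATEST m. p m \<noteq> 0) = coloring_monomial G f"
    by (intro Greatest_equality)
  then show ?thesis
    using \<open>p (coloring_monomial G f) \<noteq> 0\<close>
    by (auto simp: sampling_function_def max_monomial_def p_def)
qed

section \<open>Coheights and delayed colorings\<close>

definition level :: "('a, 'b) pre_digraph \<Rightarrow> 'a \<Rightarrow> nat \<Rightarrow> 'a set" where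
  "level G r h = {v \<in> verts G. coheight G r v = h}"

text \<open>A function on the whole vertex type; \<open>restrict\<close> is applied where membership
  in \<open>increasing_colorings\<close>, whose elements are extensional, is at stake.\<close>

definition delayed :: "('a, 'b) pre_digraph \<Rightarrow> 'a \<Rightarrow> 'a set \<Rightarrow> 'a \<Rightarrow> nat" where
  "delayed G r K v =
     Suc (coheight G r v) + (if v \<in> (\<Union>w\<in>K. subtree_verts G w) then 1 else 0)"

text \<open>The color \<open>i\<close> belongs to the coheight \<open>i - 1\<close>; the value at \<open>0\<close> is irrelevant.\<close>

definition delay_exponents :: "('a, 'b) pre_digraph \<Rightarrow> 'a \<Rightarrow> nat \<Rightarrow> nat \<Rightarrow> nat \<Rightarrow> nat" where
  "delay_exponents G r h k i =
     (if i \<le> h then card (level G r (i - 1)) else card (level G r h) - k)"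

context rooted_tree
begin

section \<open>Coheights, reachability and increasing colorings\<close>

abbreviation "d \<equiv> coheight G r"

lemma coheight_eq_length: "awalk r p v \<Longrightarrow> d v = length p"
  using unique_walk[of v] awalk_last_in_verts unfolding coheight_def
  by (metis (mono_tags, lifting) the_equality)

lemma coheight_root: "d r = 0"
  using coheight_eq_length[of "[]" r] root_in_verts by (simp add: awalk_Nil_iff)

lemma coheight_arc:
  assumes "u \<rightarrow>\<^bsub>G\<^esub> v"
  shows "d v = Suc (d u)"
proof -
  obtain p where p: "awalk r p u"
    using unique_walk assms adj_in_verts by blast
  obtain a where "a \<in> arcs G" "tail G a = u" "head G a = v"
    using assms by auto
  then have "awalk r (p @ [a]) v"
    using p arc_implies_awalk awalk_appendI by blast
  from coheight_eq_length[OF this] coheight_eq_length[OF p] show ?thesis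
    by simp
qed

lemma root_reachable: "v \<in> verts G \<Longrightarrow> r \<rightarrow>\<^sup>*\<^bsub>G\<^esub> v"
  using unique_walk reachable_awalk by blast

lemma coheight_mono: "u \<rightarrow>\<^sup>*\<^bsub>G\<^esub> v \<Longrightarrow> d u \<le> d v"
  by (induction rule: reachable_induct) (auto dest: coheight_arc)

text \<open>Along an arc the color grows by at least one and the coheight by exactly one, so the
  excess of color over coheight never drops. The additive form avoids truncated subtraction.\<close>

lemma increasing_coloring_reachable:
  assumes "f \<in> increasing_colorings G" and "u \<rightarrow>\<^sup>*\<^bsub>G\<^esub> v"
  shows "f u + d v \<le> f v + d u"
  using assms(2)
proof (induction rule: reachable_induct)
  case (step v w)
  then have "f v < f w" "d w = Suc (d v)"
    using assms(1) coheight_arc by (auto simp: increasing_colorings_def)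
  then show ?case
    using step by simp
qed simp

lemma coheight_less_coloring:
  assumes "f \<in> increasing_colorings G" and "v \<in> verts G"
  shows "d v < f v"
proof -
  have "1 \<le> f r"
    using assms root_in_verts by (auto simp: increasing_colorings_def)
  then show ?thesis
    using increasing_coloring_reachable[OF assms(1) root_reachable[OF assms(2)]] coheight_root
    by simp
qed

text \<open>The walks from the root to \<open>u\<close> through \<open>v\<close> and through
  \<open>w\<close> coincide, and their prefixes ending in \<open>v\<close> and \<open>w\<close> have
  equal length.\<close>

lemma ancestor_at_coheight_unique:
  assumes "v \<rightarrow>\<^sup>*\<^bsub>G\<^esub> u" "w \<rightarrow>\<^sup>*\<^bsub>G\<^esub> u" "d v = d w"
  shows "v = w"
proof -
  obtain p q where pq: "awalk v p u" "awalk w q u"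
    using assms reachable_awalk by blast
  obtain a b where ab: "awalk r a v" "awalk r b w"
    using unique_walk assms reachable_in_verts by meson
  have "awalk r (a @ p) u" "awalk r (b @ q) u"
    using pq ab awalk_appendI by blast+
  then have "a @ p = b @ q"
    using unique_walk awalk_last_in_verts by blast
  moreover have "length a = length b"
    using assms ab coheight_eq_length by simp
  ultimately have "a = b"
    by simp
  then show ?thesis
    using awalk_ends[OF ab(1), of r w] ab(2) by auto
qed

lemma finite_level [simp]: "finite (level G r h)"
  by (simp add: level_def)

lemma subtree_verts_subset: "subtree_verts G v \<subseteq> verts G"
  by (auto simp: subtree_verts_def dest: reachable_in_verts)

section \<open>Delayed colorings and their color classes\<close>

lemma delayed_increasing:
  "restrict (delayed G r K) (verts G) \<in> increasing_colorings G"
proof -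
  have less: "delayed G r K u < delayed G r K v" if arc: "u \<rightarrow>\<^bsub>G\<^esub> v" for u v
  proof -
    have "u \<in> (\<Union>w\<in>K. subtree_verts G w) \<longrightarrow> v \<in> (\<Union>w\<in>K. subtree_verts G w)"
      using reachable_adj_trans[OF _ arc] by (auto simp: subtree_verts_def)
    then show ?thesis
      using coheight_arc[OF arc] unfolding delayed_def by simp
  qed
  have "restrict (delayed G r K) (verts G) \<in> verts G \<rightarrow>\<^sub>E {1..}"
    by (simp add: delayed_def)
  moreover have "restrict (delayed G r K) (verts G) u < restrict (delayed G r K) (verts G) v"
    if "u \<rightarrow>\<^bsub>G\<^esub> v" for u v
    using less[OF that] adj_in_verts[OF that] by simp
  ultimately show ?thesis
    unfolding increasing_colorings_def by blast
qed

lemma coloring_monomial_restrict: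
  "coloring_monomial G (restrict f (verts G)) = coloring_monomial G f"
  unfolding coloring_monomial_def by (intro sum.cong) simp_all

text \<open>The subtrees of \<open>K\<close> live at coheights at least \<open>h\<close> and meet
  level \<open>h\<close> only in \<open>K\<close>. Delayed vertices thus have colors above
  \<open>Suc h\<close>: the classes up to \<open>Suc h\<close> gain nothing and lose only
  \<open>K\<close>.\<close>

lemma delayed_class_below:
  assumes "K \<subseteq> level G r h" "i \<le> h"
  shows "{v\<in>verts G. delayed G r K v = Suc i} = level G r i - (if i = h then K else {})"
proof -
  have sub: "h \<le> d v" if "v \<in> (\<Union>w\<in>K. subtree_verts G w)" for v
    using that assms(1) by (auto simp: level_def subtree_verts_def dest!: coheight_mono)
  have top: "v \<in> K"
    if v: "v \<in> (\<Union>w\<in>K. subtree_verts G w)" "d v = h" "v \<in> verts G" for v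
  proof -
    obtain w where w: "w \<in> K" "w \<rightarrow>\<^sup>*\<^bsub>G\<^esub> v"
      using v(1) by (auto simp: subtree_verts_def)
    then have "d w = d v"
      using assms(1) v(2) by (auto simp: level_def)
    then show ?thesis
      using ancestor_at_coheight_unique[OF w(2) reachable_refl[OF v(3)]] w(1) by simp
  qed
  have KU: "v \<in> (\<Union>w\<in>K. subtree_verts G w)" if "v \<in> K" for v
    using assms(1) that by (force simp: level_def subtree_verts_def)
  show ?thesis
  proof (rule set_eqI)
    fix v
    show "v \<in> {v\<in>verts G. delayed G r K v = Suc i} \<longleftrightarrow>
        v \<in> level G r i - (if i = h then K else {})"
    proof (cases "v \<in> (\<Union>w\<in>K. subtree_verts G w)")
      case True
      then show ?thesis
        using sub[OF True] top[OF True] assms(2) unfolding delayed_def level_def by simp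
    next
      case False
      then show ?thesis
        using KU[of v] unfolding delayed_def level_def by auto
    qed
  qed
qed

lemma card_delayed_class:
  assumes "K \<subseteq> level G r h" "i \<in> {1..Suc h}"
  shows "card {v\<in>verts G. delayed G r K v = i} = delay_exponents G r h (card K) i"
proof -
  obtain j where j: "i = Suc j" "j \<le> h"
    using assms(2) by (cases i) auto
  have "finite K"
    using assms(1) finite_level finite_subset by blast
  then have "card (level G r h - K) = card (level G r h) - card K"
    using assms(1) by (rule card_Diff_subset)
  then show ?thesis
    using j(2) unfolding j(1) delayed_class_below[OF assms(1) j(2)] delay_exponents_def
    by (cases "j = h") simp_all
qed

text \<open>The prescribed class sizes force the levels below \<open>h\<close> to take their least
  colors. With \<open>K\<close> the vertices of level \<open>h\<close> that miss the color
  \<open>Suc h\<close>, \<open>f\<close> is pointwise at least \<open>delayed G r K\<close>.\<close>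

lemma constrained_coloring_le_delayed:
  assumes f: "f \<in> increasing_colorings G" and "k \<le> card (level G r h)"
    and e: "\<And>i. i \<in> {1..Suc h} \<Longrightarrow> card {v\<in>verts G. f v = i} = delay_exponents G r h k i"
  obtains K where "K \<subseteq> level G r h" "card K = k"
    "coloring_monomial G f \<le> coloring_monomial G (delayed G r K)"
proof
  define K where "K = {v \<in> level G r h. f v \<noteq> Suc h}"
  show KL: "K \<subseteq> level G r h"
    by (auto simp: K_def)
  \<comment> \<open>A vertex of color \<open>Suc i\<close> has coheight at most \<open>i\<close>; a
    smaller coheight is impossible because those levels already carry other colors.\<close>
  have sub: "{v\<in>verts G. f v = Suc i} \<subseteq> level G r i"
    if "\<And>j. j < i \<Longrightarrow> {v\<in>verts G. f v = Suc j} = level G r j" for i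
  proof
    fix v assume v: "v \<in> {v\<in>verts G. f v = Suc i}"
    then have "d v \<le> i"
      using coheight_less_coloring[OF f, of v] by auto
    moreover have "\<not> d v < i"
    proof
      assume less: "d v < i"
      have "v \<in> level G r (d v)"
        using v by (simp add: level_def)
      then have "f v = Suc (d v)"
        unfolding that[OF less, symmetric] by simp
      then show False
        using v less by simp
    qed
    ultimately show "v \<in> level G r i"
      using v by (auto simp: level_def)
  qed
  have low: "{v\<in>verts G. f v = Suc i} = level G r i" if "i < h" for i
    using that
  proof (induction i rule: less_induct)
    case (less i)
    then have "{v\<in>verts G. f v = Suc i} \<subseteq> level G r i"
      by (intro sub) auto
    moreover have "card {v\<in>verts G. f v = Suc i} = card (level G r i)"
      using e[of "Suc i"] less by (simp add: delay_exponents_def)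
    ultimately show ?case
      by (simp add: card_subset_eq)
  qed
  have "K = level G r h - {v\<in>verts G. f v = Suc h}"
    by (auto simp: K_def level_def)
  moreover have "{v\<in>verts G. f v = Suc h} \<subseteq> level G r h"
    using low by (intro sub) auto
  moreover have "card {v\<in>verts G. f v = Suc h} = card (level G r h) - k"
    using e[of "Suc h"] by (simp add: delay_exponents_def)
  ultimately show "card K = k"
    using assms(2) by (simp add: card_Diff_subset)
  \<comment> \<open>At \<open>w\<close> in \<open>K\<close> the color exceeds the coheight by at
    least 2, and this excess persists throughout the subtree of \<open>w\<close>.\<close>
  have "delayed G r K v \<le> f v" if v: "v \<in> verts G" for v
  proof (cases "v \<in> (\<Union>w\<in>K. subtree_verts G w)")
    case True
    then obtain w where w: "w \<in> K" "w \<rightarrow>\<^sup>*\<^bsub>G\<^esub> v"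
      by (auto simp: subtree_verts_def)
    then have "d w = h" "Suc h < f w"
      using coheight_less_coloring[OF f, of w] by (auto simp: K_def level_def)
    then show ?thesis
      using increasing_coloring_reachable[OF f w(2)] True by (simp add: delayed_def)
  next
    case False
    then show ?thesis
      using coheight_less_coloring[OF f v] by (simp add: delayed_def)
  qed
  then show "coloring_monomial G f \<le> coloring_monomial G (delayed G r K)"
    by (intro coloring_monomial_antimono) auto
qed

section \<open>Values of the sampling function\<close>

lemma sampling_function_no_constraint:
  "sampling_function G 0 e = Some (coloring_monomial G (\<lambda>v. Suc (d v)))"
proof -
  have d_eq: "delayed G r {} = (\<lambda>v. Suc (d v))"
    by (simp add: delayed_def fun_eq_iff)
  \<comment> \<open>For \<open>n = 0\<close> the range \<open>{1..n}\<close> is empty, so every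
    increasing coloring competes, and the undelayed one is pointwise least.\<close>
  have "sampling_function G 0 e =
      Some (coloring_monomial G (restrict (delayed G r {}) (verts G)))"
  proof (intro sampling_function_eqI delayed_increasing)
    fix g assume "g \<in> increasing_colorings G"
    then show "coloring_monomial G g \<le>
        coloring_monomial G (restrict (delayed G r {}) (verts G))"
      unfolding coloring_monomial_restrict d_eq
      by (intro coloring_monomial_antimono) (simp_all add: coheight_less_coloring Suc_le_eq)
  qed simp_all
  then show ?thesis
    by (simp only: coloring_monomial_restrict d_eq)
qed

text \<open>Level sizes depend on the sampling function alone, so equal sampling functions lead to
  the same \<open>delay_exponents\<close>.\<close>

lemma card_level_eq_lookup:
  "card (level G r h) =
     Poly_Mapping.lookup (the (sampling_function G 0 (\<lambda>_. 0))) (Suc h)"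
  by (simp add: sampling_function_no_constraint lookup_coloring_monomial level_def)

text \<open>Each admissible coloring is dominated by a delayed one, so a maximum over the finitely
  many \<open>k\<close>-subsets of level \<open>h\<close> suffices; the bound on \<open>k\<close>
  makes this family nonempty.\<close>

lemma sampling_function_delay:
  assumes "k \<le> card (level G r h)"
  obtains K where "K \<subseteq> level G r h" "card K = k"
    "sampling_function G (Suc h) (delay_exponents G r h k) =
       Some (coloring_monomial G (delayed G r K))"
    "\<And>K'. K' \<subseteq> level G r h \<Longrightarrow> card K' = k \<Longrightarrow>
       coloring_monomial G (delayed G r K') \<le> coloring_monomial G (delayed G r K)"
proof -
  let ?S = "{K. K \<subseteq> level G r h \<and> card K = k}"
  let ?M = "(\<lambda>K. coloring_monomial G (delayed G r K)) ` ?S"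
  have fin: "finite ?M"
    using finite_level by simp
  have "?M \<noteq> {}"
    using obtain_subset_with_card_n[OF assms] by auto
  then have "Max ?M \<in> ?M"
    using fin by (rule Max_in[rotated])
  then obtain K where K: "K \<subseteq> level G r h" "card K = k"
    "Max ?M = coloring_monomial G (delayed G r K)"
    by auto
  have max: "coloring_monomial G (delayed G r K') \<le> coloring_monomial G (delayed G r K)"
    if "K' \<subseteq> level G r h" "card K' = k" for K'
    using Max_ge[OF fin] that K(3) by auto
  have restrict_class: "{v\<in>verts G. restrict g (verts G) v = i} = {v\<in>verts G. g v = i}"
    for g :: "'a \<Rightarrow> nat" and i
    by auto
  have "sampling_function G (Suc h) (delay_exponents G r h k) =
      Some (coloring_monomial G (restrict (delayed G r K) (verts G)))"
  proof (intro sampling_function_eqI delayed_increasing)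
    fix i assume "i \<in> {1..Suc h}"
    then show "card {v\<in>verts G. restrict (delayed G r K) (verts G) v = i} =
        delay_exponents G r h k i"
      using card_delayed_class[OF K(1)] K(2) by (simp only: restrict_class)
  next
    fix g assume "g \<in> increasing_colorings G"
      "\<And>i. i \<in> {1..Suc h} \<Longrightarrow> card {v\<in>verts G. g v = i} = delay_exponents G r h k i"
    then obtain K' where "K' \<subseteq> level G r h" "card K' = k"
      "coloring_monomial G g \<le> coloring_monomial G (delayed G r K')"
      using constrained_coloring_le_delayed[OF _ assms] by metis
    then show "coloring_monomial G g \<le>
        coloring_monomial G (restrict (delayed G r K) (verts G))"
      unfolding coloring_monomial_restrict using max order_trans by blast
  qed simp
  then show ?thesis
    using that K max by (simp add: coloring_monomial_restrict)
qed

section \<open>Delayed monomials in terms of profile products\<close>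

lemma lookup_sum_coheight_profile:
  assumes "K \<subseteq> level G r h"
  shows "Poly_Mapping.lookup (\<Sum>v\<in>K. coheight_profile G r v) i =
    card {u \<in> (\<Union>w\<in>K. subtree_verts G w). d u = i}"
proof -
  have "(\<Sum>v\<in>K. coheight_profile G r v) =
      (\<Sum>u\<in>(\<Union>w\<in>K. subtree_verts G w). Poly_Mapping.single (d u) 1)"
    unfolding coheight_profile_def
  proof (rule sum.UNION_disjoint[symmetric])
    show "finite K"
      using assms finite_level finite_subset by blast
    show "\<forall>v\<in>K. finite (subtree_verts G v)"
      using subtree_verts_subset finite_verts finite_subset by blast
    \<comment> \<open>A common descendant would have two different ancestors of the same
      coheight.\<close>
    show "\<forall>v\<in>K. \<forall>w\<in>K. v \<noteq> w \<longrightarrow> subtree_verts G v \<inter> subtree_verts G w = {}"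
    proof (intro ballI impI equals0I)
      fix v w u
      assume "v \<in> K" "w \<in> K" "v \<noteq> w" "u \<in> subtree_verts G v \<inter> subtree_verts G w"
      then have "v \<rightarrow>\<^sup>*\<^bsub>G\<^esub> u" "w \<rightarrow>\<^sup>*\<^bsub>G\<^esub> u" "d v = d w"
        using assms by (auto simp: subtree_verts_def level_def)
      then show False
        using ancestor_at_coheight_unique \<open>v \<noteq> w\<close> by blast
    qed
  qed
  moreover have "finite (\<Union>w\<in>K. subtree_verts G w)"
    using subtree_verts_subset finite_verts by (meson UN_least finite_subset)
  ultimately show ?thesis
    by (simp only: lookup_sum_single)
qed

text \<open>The class of color \<open>Suc i\<close> consists of the undelayed vertices of level
  \<open>i\<close> and the delayed ones of level \<open>i - 1\<close>. The lost vertices are moved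
  to the left side to stay clear of truncated subtraction.\<close>

lemma lookup_delayed:
  assumes "K \<subseteq> level G r h"
  shows "Poly_Mapping.lookup (coloring_monomial G (delayed G r K)) 0 = 0"
    and "Poly_Mapping.lookup (coloring_monomial G (delayed G r K)) (Suc i) +
        Poly_Mapping.lookup (\<Sum>v\<in>K. coheight_profile G r v) i =
      card (level G r i) +
        (if i = 0 then 0 else Poly_Mapping.lookup (\<Sum>v\<in>K. coheight_profile G r v) (i - 1))"
proof -
  let ?U = "\<Union>w\<in>K. subtree_verts G w"
  have U: "?U \<subseteq> verts G"
    using subtree_verts_subset by blast
  then have finU: "finite ?U"
    by (rule finite_subset) simp
  show "Poly_Mapping.lookup (coloring_monomial G (delayed G r K)) 0 = 0"
    by (simp add: lookup_coloring_monomial delayed_def)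
  define B where "B = (if i = 0 then {} else {u \<in> ?U. d u = i - 1})"
  have "{v\<in>verts G. delayed G r K v = Suc i} = (level G r i - {u \<in> ?U. d u = i}) \<union> B"
    using U by (auto simp: delayed_def level_def B_def split: if_splits)
  moreover have "finite B"
    by (rule finite_subset[OF _ finU]) (auto simp: B_def split: if_splits)
  then have "card ((level G r i - {u \<in> ?U. d u = i}) \<union> B) =
      card (level G r i - {u \<in> ?U. d u = i}) + card B"
    by (intro card_Un_disjoint) (auto simp: B_def level_def)
  moreover have "card (level G r i) =
      card (level G r i - {u \<in> ?U. d u = i}) + card {u \<in> ?U. d u = i}"
  proof -
    have "{u \<in> ?U. d u = i} \<subseteq> level G r i"
      using U by (auto simp: level_def)
    then show ?thesis
      using card_Diff_subset[of "{u \<in> ?U. d u = i}" "level G r i"]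
        card_mono[of "level G r i" "{u \<in> ?U. d u = i}"] finite_subset[OF _ finite_level] by simp
  qed
  ultimately show "Poly_Mapping.lookup (coloring_monomial G (delayed G r K)) (Suc i) +
        Poly_Mapping.lookup (\<Sum>v\<in>K. coheight_profile G r v) i =
      card (level G r i) +
        (if i = 0 then 0 else Poly_Mapping.lookup (\<Sum>v\<in>K. coheight_profile G r v) (i - 1))"
    unfolding lookup_sum_coheight_profile[OF assms]
    by (simp add: lookup_coloring_monomial B_def)
qed

section \<open>Decomposition by coheight\<close>

lemma coheight_profile_profile_eq_sum_levels:
  assumes "\<And>h. N \<le> h \<Longrightarrow> level G r h = {}"
  shows "coheight_profile_profile G r =
    (\<Sum>h<N. \<Sum>v\<in>level G r h. Poly_Mapping.single (coheight_profile G r v) 1)"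
proof -
  have "d ` verts G \<subseteq> {..<N}"
    using assms by (force simp: level_def not_less[symmetric])
  then show ?thesis
    unfolding coheight_profile_profile_def level_def
    by (intro sum.group[symmetric]) auto
qed

lemma levels_bounded:
  obtains N where "\<And>h. N \<le> h \<Longrightarrow> level G r h = {}"
proof
  fix h assume "Suc (Max (d ` verts G)) \<le> h"
  moreover have "d v \<le> Max (d ` verts G)" if "v \<in> verts G" for v
    using that by simp
  ultimately show "level G r h = {}"
    by (fastforce simp: level_def)
qed

end

section \<open>Comparison of two trees\<close>

text \<open>At the first index \<open>k\<close> where the profile products differ, color
  \<open>Suc k\<close> gains equally many vertices from level \<open>k - 1\<close> in both trees,
  but loses more of level \<open>k\<close> for the larger product. All earlier exponents
  agree.\<close>

lemma delayed_monomial_strict_antimono: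
  assumes "rooted_tree T r" "rooted_tree T' r'"
    and levels: "\<And>i. card (level T r i) = card (level T' r' i)"
    and K: "K \<subseteq> level T r h" and K': "K' \<subseteq> level T' r' h"
    and less: "(\<Sum>v\<in>K. coheight_profile T r v) < (\<Sum>v\<in>K'. coheight_profile T' r' v)"
  shows "coloring_monomial T' (delayed T' r' K') < coloring_monomial T (delayed T r K)"
proof -
  interpret T: rooted_tree T r by fact
  interpret T': rooted_tree T' r' by fact
  obtain k where k:
    "Poly_Mapping.lookup (\<Sum>v\<in>K. coheight_profile T r v) k <
      Poly_Mapping.lookup (\<Sum>v\<in>K'. coheight_profile T' r' v) k"
    "\<And>i. i < k \<Longrightarrow> Poly_Mapping.lookup (\<Sum>v\<in>K. coheight_profile T r v) i =
      Poly_Mapping.lookup (\<Sum>v\<in>K'. coheight_profile T' r' v) i"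
    using less by (auto simp: monomial_less_iff)
  note l = T.lookup_delayed[OF K] T'.lookup_delayed[OF K']
  have "Poly_Mapping.lookup (coloring_monomial T' (delayed T' r' K')) (Suc k) <
      Poly_Mapping.lookup (coloring_monomial T (delayed T r K)) (Suc k)"
    using l(2)[of k] l(4)[of k] levels[of k] k(1) k(2)[of "k - 1"] by (cases k) auto
  moreover have "Poly_Mapping.lookup (coloring_monomial T' (delayed T' r' K')) i =
      Poly_Mapping.lookup (coloring_monomial T (delayed T r K)) i" if "i < Suc k" for i
  proof (cases i)
    case 0
    then show ?thesis
      using l by simp
  next
    case (Suc j)
    then show ?thesis
      using l(2)[of j] l(4)[of j] levels[of j] k(2)[of j] k(2)[of "j - 1"] that
      by (cases j) auto
  qed
  ultimately show ?thesis
    unfolding monomial_less_iff by blast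
qed

text \<open>\<open>K'\<close> is taken optimal for \<open>T'\<close>. Its monomial is the common
  value of the sampling functions and so bounds that of \<open>K\<close>; a larger profile product
  for \<open>K'\<close> would contradict strict antitonicity.\<close>

lemma min_profile_sum_le:
  assumes T: "rooted_tree T r" and T': "rooted_tree T' r'"
    and sampling: "sampling_function T = sampling_function T'"
    and levels: "\<And>i. card (level T r i) = card (level T' r' i)"
    and K: "K \<subseteq> level T r h"
  shows "\<exists>K'\<subseteq>level T' r' h. card K' = card K \<and>
    sum (coheight_profile T' r') K' \<le> sum (coheight_profile T r) K"
proof -
  interpret T: rooted_tree T r by fact
  interpret T': rooted_tree T' r' by fact
  have exponents: "delay_exponents T r h k = delay_exponents T' r' h k" for k
    using levels by (auto simp: delay_exponents_def)
  have card_le: "card K \<le> card (level T r h)"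
    using K by (simp add: card_mono)
  obtain M where M: "sampling_function T (Suc h) (delay_exponents T r h (card K)) =
      Some (coloring_monomial T (delayed T r M))"
    "coloring_monomial T (delayed T r K) \<le> coloring_monomial T (delayed T r M)"
    using T.sampling_function_delay[OF card_le] K by metis
  obtain K' where K': "K' \<subseteq> level T' r' h" "card K' = card K"
    "sampling_function T' (Suc h) (delay_exponents T' r' h (card K)) =
      Some (coloring_monomial T' (delayed T' r' K'))"
    using T'.sampling_function_delay[of "card K" h] card_le levels by metis
  have "coloring_monomial T (delayed T r K) \<le> coloring_monomial T' (delayed T' r' K')"
    using M K'(3) sampling exponents by simp
  then have "\<not> sum (coheight_profile T r) K < sum (coheight_profile T' r') K'"
    using delayed_monomial_strict_antimono[OF T T' levels K K'(1)] leD by blast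
  then show ?thesis
    using K' by (auto simp: not_less)
qed

theorem theorem5p6:
  fixes T :: "('a, 'b) pre_digraph" and T' :: "('c, 'd) pre_digraph"
  assumes "rooted_tree T r" and "rooted_tree T' r'"
    and "sampling_function T = sampling_function T'"
  shows "coheight_profile_profile T r = coheight_profile_profile T' r'"
proof -
  interpret T: rooted_tree T r by fact
  interpret T': rooted_tree T' r' by fact
  have levels: "card (level T r i) = card (level T' r' i)" for i
    using T.card_level_eq_lookup[of i] T'.card_level_eq_lookup[of i] assms(3) by simp
  have mset_eq: "image_mset (coheight_profile T r) (mset_set (level T r h)) =
      image_mset (coheight_profile T' r') (mset_set (level T' r' h))" for h
    using levels min_profile_sum_le[OF assms levels]
      min_profile_sum_le[OF assms(2,1) assms(3)[symmetric] levels[symmetric]]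
    by (intro image_mset_eq_if_min_subset_sums_eq) auto
  \<comment> \<open>Each sum depends only on the multiset of profiles at coheight
    \<open>h\<close>.\<close>
  have level_sums: "(\<Sum>v\<in>level T r h. Poly_Mapping.single (coheight_profile T r v) (1::nat)) =
      (\<Sum>v\<in>level T' r' h. Poly_Mapping.single (coheight_profile T' r' v) 1)" for h
    using arg_cong[OF mset_eq[of h],
        of "\<lambda>M. sum_mset (image_mset (\<lambda>m. Poly_Mapping.single m (1::nat)) M)"]
    by (simp add: sum_unfold_sum_mset multiset.map_comp comp_def)
  obtain N where N: "\<And>h. N \<le> h \<Longrightarrow> level T r h = {}"
    using T.levels_bounded by blast
  \<comment> \<open>Equal cardinalities carry emptiness over, since the levels of \<open>T'\<close>
    are finite; hence one bound \<open>N\<close> serves both trees.\<close>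
  then have N': "\<And>h. N \<le> h \<Longrightarrow> level T' r' h = {}"
    using levels T'.finite_level by (metis card_0_eq card.empty)
  show ?thesis
    using level_sums by (simp add: T.coheight_profile_profile_eq_sum_levels[OF N]
        T'.coheight_profile_profile_eq_sum_levels[OF N'])
qed

end
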